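(* For every integer $n \geq 4$, the diameter of the cubical staircase graph $CS_n$ is $\operatorname{diam}(CS_n) = 3(n-3)$.
   Context: For a natural number $n \geq 3$, the cubical staircase graph $CS_n$ is the graph with vertex set $\{(i,j,k) : 1 \leq i \leq n-2,\ 1 \leq j \leq i,\ 1 \leq k \leq n-1-i\}$ and edge set consisting of the pairs $(i,j,k)(i,j,k+1)$ for $1\le i\le n-2$, $1\le j\le i$, $1\le k\le n-2-i$; the pairs $(i,j,k)(i+1,j,k)$ for $1\le i\le n-3$, $1\le j\le i$, $1\le k\le n-1-i$; and the pairs $(i,j,k)(i,j+1,k)$ for $1\le i\le n-2$, $1\le j\le i-1$, $1\le k\le n-1-i$ (only pairs of vertices of $CS_n$ are included). The diameter is $\operatorname{diam}(G)=\max\{d_G(u,v): u,v\in V(G)\}$, where $d_G$ is the shortest-path distance. *)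

theory Defs
  imports "Graph_Theory.Graph_Theory"
begin

text \<open>
  Distance and diameter with every arc of weight 1, so that the cost of a walk is its
  number of arcs. As values of type \<^typ>\<open>ereal\<close>, a distance between vertices in different
  components is infinite. \<^const>\<open>Max\<close> is meaningful for nonempty finite graphs only.
\<close>

definition graph_dist :: "('a, 'b) pre_digraph \<Rightarrow> 'a \<Rightarrow> 'a \<Rightarrow> ereal" where
  "graph_dist G u v = wf_digraph.\<mu> G (\<lambda>_. 1) u v"

definition graph_diam :: "('a, 'b) pre_digraph \<Rightarrow> ereal" where
  "graph_diam G = Max {graph_dist G u v | u v. u \<in> verts G \<and> v \<in> verts G}"

definition CS_verts :: "nat \<Rightarrow> (nat \<times> nat \<times> nat) set" where
  "CS_verts n = {(i, j, k). 1 \<le> i \<and> i \<le> n - 2 \<and> 1 \<le> j \<and> j \<le> i \<and> 1 \<le> k \<and> k \<le> n - 1 - i}"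

text \<open>
  For \<open>n \<ge> 3\<close> no subtraction below truncates within the stated ranges.
  In the second family the pair with \<open>k = n - 1 - i\<close> leaves the vertex set; such pairs are
  removed when the graph is formed.
\<close>

definition CS_pairs :: "nat \<Rightarrow> (nat \<times> nat \<times> nat) rel" where
  "CS_pairs n =
     {((i, j, k), (i, j, k + 1)) | i j k.
        1 \<le> i \<and> i \<le> n - 2 \<and> 1 \<le> j \<and> j \<le> i \<and> 1 \<le> k \<and> k \<le> n - 2 - i} \<union>
     {((i, j, k), (i + 1, j, k)) | i j k.
        1 \<le> i \<and> i \<le> n - 3 \<and> 1 \<le> j \<and> j \<le> i \<and> 1 \<le> k \<and> k \<le> n - 1 - i} \<union>
     {((i, j, k), (i, j + 1, k)) | i j k.
        1 \<le> i \<and> i \<le> n - 2 \<and> 1 \<le> j \<and> j \<le> i - 1 \<and> 1 \<le> k \<and> k \<le> n - 1 - i}"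

text \<open>An undirected edge is represented by its two opposite arcs.\<close>

definition CS :: "nat \<Rightarrow> (nat \<times> nat \<times> nat) pair_pre_digraph" where
  "CS n = \<lparr>pverts = CS_verts n,
           parcs = symcl (CS_pairs n \<inter> CS_verts n \<times> CS_verts n)\<rparr>"

lemma pair_graph_CS: "pair_graph (CS n)"
proof -
  have "CS_verts n \<subseteq> {..n} \<times> {..n} \<times> {..n}"
    by (auto simp: CS_verts_def)
  then have fin: "finite (CS_verts n)"
    by (rule finite_subset) simp
  have sub: "parcs (CS n) \<subseteq> CS_verts n \<times> CS_verts n"
    by (auto simp: CS_def symcl_def)
  have sym: "sym (parcs (CS n))"
    by (auto simp: CS_def symcl_def sym_def)
  have loopfree: "fst e \<noteq> snd e" if "e \<in> parcs (CS n)" for e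
    using that by (auto simp: CS_def symcl_def CS_pairs_def)
  have V: "pverts (CS n) = CS_verts n"
    by (simp add: CS_def)
  show ?thesis
  proof
    show "finite (parcs (CS n))"
      using sub fin by (meson finite_SigmaI finite_subset)
  qed (use fin sub sym loopfree in \<open>auto simp: V symmetric_def\<close>)
qed

lemma graph_dist_CS:
  "graph_dist (with_proj (CS n)) u v =
     (INF p\<in>{p. pre_digraph.awalk (with_proj (CS n)) u p v}. ereal (real (length p)))"
proof -
  interpret G: pair_graph "CS n" by (rule pair_graph_CS)
  show ?thesis
    by (simp add: graph_dist_def G.\<mu>_def G.awalk_cost_def sum_list_triv)
qed

end

theory Submission
  imports Defs
begin

text \<open>
  The distance in \<open>CS n\<close> is the taxicab distance, which is at most \<open>3 * (n - 3)\<close> because each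
  coordinate ranges over \<open>{1..n - 2}\<close>; the vertices \<open>(1, 1, n - 2)\<close> and \<open>(n - 2, n - 2, 1)\<close>
  attain the bound. To approach a target \<open>(i', j', k')\<close> greedily from \<open>(i, j, k)\<close> without leaving
  the graph, correct \<open>k\<close> before increasing \<open>i\<close>, and correct \<open>j\<close> before decreasing \<open>i\<close>.
\<close>

text \<open>The differences are taken in \<open>int\<close> because subtraction on
  \<open>nat\<close> truncates.\<close>

fun taxicab :: "nat \<times> nat \<times> nat \<Rightarrow> nat \<times> nat \<times> nat \<Rightarrow> nat" where
  "taxicab (i, j, k) (i', j', k') =
     nat (\<bar>int i - int i'\<bar> + \<bar>int j - int j'\<bar> + \<bar>int k - int k'\<bar>)"

lemma taxicab_eq_0_iff: "taxicab u v = 0 \<longleftrightarrow> u = v"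
  by (cases u; cases v) auto

lemma taxicab_triangle: "taxicab u w \<le> taxicab u v + taxicab v w"
proof -
  obtain i j k i' j' k' i'' j'' k'' where [simp]: "u = (i, j, k)" "v = (i', j', k')"
    "w = (i'', j'', k'')"
    by (cases u; cases v; cases w) blast
  \<comment> \<open>Variables stand in for the absolute values, so the three coordinatewise
    inequalities only have to be added.\<close>
  have nat_le: "nat (a + b + c) \<le> nat (a' + b' + c') + nat (a'' + b'' + c'')"
    if "a \<le> a' + a''" "b \<le> b' + b''" "c \<le> c' + c''" for a b c a' b' c' a'' b'' c'' :: int
    using that by linarith
  have "\<bar>int x - int z\<bar> \<le> \<bar>int x - int y\<bar> + \<bar>int y - int z\<bar>" for x y z
    by linarith
  then show ?thesis
    by (simp only: taxicab.simps \<open>u = _\<close> \<open>v = _\<close> \<open>w = _\<close> nat_le)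
qed

lemma taxicab_arc:
  assumes "(u, v) \<in> parcs (CS n)"
  shows "taxicab u v = 1"
  using assms by (auto simp: CS_def symcl_def CS_pairs_def)

text \<open>Once both endpoints are vertices, the index ranges in \<open>CS_pairs\<close> hold
  automatically. Hence finding an arc reduces to checking that the neighbouring grid point is a
  vertex.\<close>

lemma arc_up_i:
  assumes "(i, j, k) \<in> CS_verts n" "(i + 1, j, k) \<in> CS_verts n"
  shows "((i, j, k), (i + 1, j, k)) \<in> parcs (CS n)" "((i + 1, j, k), (i, j, k)) \<in> parcs (CS n)"
  using assms by (auto simp: CS_def symcl_def CS_pairs_def CS_verts_def)

lemma arc_up_j:
  assumes "(i, j, k) \<in> CS_verts n" "(i, j + 1, k) \<in> CS_verts n"
  shows "((i, j, k), (i, j + 1, k)) \<in> parcs (CS n)" "((i, j + 1, k), (i, j, k)) \<in> parcs (CS n)"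
  using assms by (auto simp: CS_def symcl_def CS_pairs_def CS_verts_def)

lemma arc_up_k:
  assumes "(i, j, k) \<in> CS_verts n" "(i, j, k + 1) \<in> CS_verts n"
  shows "((i, j, k), (i, j, k + 1)) \<in> parcs (CS n)" "((i, j, k + 1), (i, j, k)) \<in> parcs (CS n)"
  using assms by (auto simp: CS_def symcl_def CS_pairs_def CS_verts_def)

lemma ex_arc_closer:
  assumes u: "u \<in> CS_verts n" and v: "v \<in> CS_verts n" and "u \<noteq> v"
  shows "\<exists>w. (u, w) \<in> parcs (CS n) \<and> Suc (taxicab w v) = taxicab u v"
proof -
  obtain i j k where [simp]: "u = (i, j, k)" by (cases u)
  obtain i' j' k' where [simp]: "v = (i', j', k')" by (cases v)
  have bnd: "1 \<le> i" "i \<le> n - 2" "1 \<le> j" "j \<le> i" "1 \<le> k" "k \<le> n - 1 - i"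
    "1 \<le> i'" "i' \<le> n - 2" "1 \<le> j'" "j' \<le> i'" "1 \<le> k'" "k' \<le> n - 1 - i'"
    using u v by (auto simp: CS_verts_def)
  \<comment> \<open>If \<open>i < i'\<close>, comparing \<open>k\<close> with \<open>k'\<close>
    gives one of the first three cases; if \<open>i' < i\<close>, comparing \<open>j\<close> with
    \<open>j'\<close> gives one of the last three. If \<open>i = i'\<close>, then \<open>j\<close>
    or \<open>k\<close> differs.\<close>
  consider "k < k'" "i \<le> i'" | "k' < k" "i \<le> i'" | "i < i'" "k = k'"
    | "j < j'" "i' \<le> i" | "j' < j" "i' \<le> i" | "i' < i" "j = j'"
    using \<open>u \<noteq> v\<close> by fastforce
  then show ?thesis
  proof cases
    case 1
    then show ?thesis
      \<comment> \<open>There is room above: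
        \<open>k < k' \<le> n - 1 - i' \<le> n - 1 - i\<close>.\<close>
      using arc_up_k(1)[of i j k n] bnd
      by (intro exI[of _ "(i, j, k + 1)"]) (auto simp: CS_verts_def)
  next
    case 2
    then obtain l where "k = l + 1"
      by (cases k) auto
    with 2 show ?thesis
      using arc_up_k(2)[of i j l n] bnd
      by (intro exI[of _ "(i, j, l)"]) (auto simp: CS_verts_def)
  next
    case 3
    then show ?thesis
      \<comment> \<open>The bound on \<open>k\<close> survives the step since
        \<open>k = k' \<le> n - 1 - i'\<close> and \<open>i + 1 \<le> i'\<close>.\<close>
      using arc_up_i(1)[of i j k n] bnd
      by (intro exI[of _ "(i + 1, j, k)"]) (auto simp: CS_verts_def)
  next
    case 4
    then show ?thesis
      \<comment> \<open>There is room since \<open>j < j' \<le> i' \<le> i\<close>.\<close>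
      using arc_up_j(1)[of i j k n] bnd
      by (intro exI[of _ "(i, j + 1, k)"]) (auto simp: CS_verts_def)
  next
    case 5
    then obtain l where "j = l + 1"
      by (cases j) auto
    with 5 show ?thesis
      using arc_up_j(2)[of i l k n] bnd
      by (intro exI[of _ "(i, l, k)"]) (auto simp: CS_verts_def)
  next
    case 6
    then obtain l where "i = l + 1"
      by (cases i) auto
    with 6 show ?thesis
      \<comment> \<open>The constraint \<open>j \<le> l\<close> holds because
        \<open>j = j' \<le> i' \<le> l\<close>.\<close>
      using arc_up_i(2)[of l j k n] bnd
      by (intro exI[of _ "(l, j, k)"]) (auto simp: CS_verts_def)
  qed
qed

interpretation CS: pair_graph "CS n" for n
  by (rule pair_graph_CS)

lemma pverts_CS [simp]: "pverts (CS n) = CS_verts n"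
  by (simp add: CS_def)

text \<open>Each arc has taxicab length 1, so the triangle inequality adds up along the
  walk.\<close>

lemma taxicab_le_length_awalk:
  assumes "pre_digraph.awalk (with_proj (CS n)) u p v"
  shows "taxicab u v \<le> length p"
  using assms
proof (induction p arbitrary: u)
  case Nil
  then show ?case
    by (simp add: CS.awalk_Nil_iff taxicab_eq_0_iff)
next
  case (Cons e p)
  then have "(u, snd e) \<in> parcs (CS n)" and "taxicab (snd e) v \<le> length p"
    by (auto simp: CS.awalk_Cons_iff)
  then show ?case
    using taxicab_triangle[of u v "snd e"] taxicab_arc[of u "snd e" n] by simp
qed

text \<open>Repeating the step of \<open>ex_arc_closer\<close> lowers the taxicab distance by 1 per
  arc until the target is reached.\<close>

lemma ex_awalk_taxicab:
  assumes "u \<in> CS_verts n" "v \<in> CS_verts n"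
  shows "\<exists>p. pre_digraph.awalk (with_proj (CS n)) u p v \<and> length p = taxicab u v"
  using assms
proof (induction "taxicab u v" arbitrary: u)
  case 0
  then have "u = v"
    by (simp add: taxicab_eq_0_iff)
  with 0 show ?case
    by (intro exI[of _ "[]"]) (simp add: CS.awalk_Nil_iff taxicab_eq_0_iff)
next
  case (Suc d)
  have "u \<noteq> v"
    using Suc.hyps(2) taxicab_eq_0_iff[of u v] by auto
  then obtain w where w: "(u, w) \<in> parcs (CS n)" "Suc (taxicab w v) = taxicab u v"
    using ex_arc_closer Suc.prems by blast
  moreover have "w \<in> CS_verts n"
    using w(1) by (auto simp: CS_def symcl_def)
  ultimately obtain p where "pre_digraph.awalk (with_proj (CS n)) w p v" "length p = taxicab w v"
    using Suc.hyps(1)[of w] Suc.hyps(2) Suc.prems by auto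
  with w show ?case
    by (intro exI[of _ "(u, w) # p"]) (simp add: CS.awalk_Cons_iff)
qed

lemma graph_dist_CS_eq_taxicab:
  assumes "u \<in> CS_verts n" "v \<in> CS_verts n"
  shows "graph_dist (with_proj (CS n)) u v = ereal (real (taxicab u v))"
  unfolding graph_dist_CS
proof (rule antisym)
  obtain p where p: "pre_digraph.awalk (with_proj (CS n)) u p v" "length p = taxicab u v"
    using ex_awalk_taxicab[OF assms] by blast
  show "(INF p\<in>{p. pre_digraph.awalk (with_proj (CS n)) u p v}. ereal (real (length p)))
      \<le> ereal (real (taxicab u v))"
    by (rule INF_lower2[of p]) (use p in simp_all)
  show "ereal (real (taxicab u v))
      \<le> (INF p\<in>{p. pre_digraph.awalk (with_proj (CS n)) u p v}. ereal (real (length p)))"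
    by (rule INF_greatest) (simp add: taxicab_le_length_awalk)
qed

text \<open>Every coordinate is at most \<open>n - 2\<close>: \<open>j\<close> because
  \<open>j \<le> i\<close>, and \<open>k\<close> because \<open>i \<ge> 1\<close>.\<close>

lemma taxicab_le_CS:
  assumes "u \<in> CS_verts n" "v \<in> CS_verts n"
  shows "taxicab u v \<le> 3 * (n - 3)"
  using assms by (cases u; cases v) (auto simp: CS_verts_def)

theorem theorem5:
  fixes n :: nat
  assumes "n \<ge> 4"
  shows "graph_diam (with_proj (CS n)) = ereal (real (3 * (n - 3)))"
proof -
  let ?D = "{graph_dist (with_proj (CS n)) u v | u v. u \<in> CS_verts n \<and> v \<in> CS_verts n}"
  have "Max ?D = ereal (real (3 * (n - 3)))"
  proof (rule Max_eqI)
    have "finite (CS_verts n)"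
      using CS.finite_verts[of n] by simp
    then show "finite ?D"
      by (intro finite_image_set2) simp_all
  next
    show "d \<le> ereal (real (3 * (n - 3)))" if "d \<in> ?D" for d
      \<comment> \<open>Without \<open>of_nat_mult\<close> the bound stays the cast of one natural
        number and matches \<open>taxicab_le_CS\<close>.\<close>
      using that taxicab_le_CS by (force simp: graph_dist_CS_eq_taxicab simp del: of_nat_mult)
  next
    \<comment> \<open>At \<open>i = 1\<close> the largest \<open>k\<close> is \<open>n - 2\<close>
      and \<open>j\<close> must be 1; at \<open>i = n - 2\<close> the largest \<open>j\<close> is
      \<open>n - 2\<close> and \<open>k\<close> must be 1.\<close>
    let ?u = "(1, 1, n - 2)" and ?v = "(n - 2, n - 2, 1)"
    have uv: "?u \<in> CS_verts n" "?v \<in> CS_verts n"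
      using assms by (auto simp: CS_verts_def)
    have "taxicab ?u ?v = 3 * (n - 3)"
      using assms by simp
    then have "ereal (real (3 * (n - 3))) = graph_dist (with_proj (CS n)) ?u ?v"
      by (simp only: graph_dist_CS_eq_taxicab[OF uv])
    with uv show "ereal (real (3 * (n - 3))) \<in> ?D"
      by blast
  qed
  then show ?thesis
    by (simp add: graph_diam_def)
qed

end
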